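(* There is an absolute constant $c>0$ such that for every $\sigma\in\{132,213,231,312\}$ and all positive integers $n,k$ there is an input sequence $X\in[0,1]^n$ that avoids $\sigma$ and satisfies $\mathrm{OPT}_k(X)\ge c\cdot 4^{-k}\cdot n^{1/k}$.
   Context: Two real sequences $(x_1,\dots,x_m)$ and $(y_1,\dots,y_m)$ are order-isomorphic if $x_i<x_j \iff y_i<y_j$ for all $i,j$. A sequence $X$ contains a sequence $Y$ if some (not necessarily contiguous) subsequence of $X$ is order-isomorphic to $Y$; otherwise $X$ avoids $Y$. $k$-server on the line: for requests $X\in[0,1]^n$ and $k$ servers, let $p_i^j\in[0,1]$ be the position of server $j$ after request $i$, with $p_0^j=0$. A solution is valid if for every $i$ some $p_i^j=x_i$; its cost is $\sum_{i}\sum_{j}|p_i^j-p_{i-1}^j|$; $\mathrm{OPT}_k(X)$ is the minimum cost. *)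

theory Defs
  imports "HOL-Analysis.Analysis" "HOL-Library.Sublist"
begin

definition order_isomorphic :: "real list \<Rightarrow> real list \<Rightarrow> bool" where
  "order_isomorphic xs ys \<longleftrightarrow> length xs = length ys \<and>
     (\<forall>i < length xs. \<forall>j < length xs. xs ! i < xs ! j \<longleftrightarrow> ys ! i < ys ! j)"

definition contains_pattern :: "real list \<Rightarrow> real list \<Rightarrow> bool" where
  "contains_pattern X Y \<longleftrightarrow> (\<exists>Z. subseq Z X \<and> order_isomorphic Z Y)"

abbreviation avoids_pattern :: "real list \<Rightarrow> real list \<Rightarrow> bool" where
  "avoids_pattern X Y \<equiv> \<not> contains_pattern X Y"

text \<open>
  \<open>p i j\<close> is the position of server \<open>j\<close> after the first \<open>i\<close> requests. The servers are
  \<open>0, \<dots>, k - 1\<close>. Time \<open>0\<close> is the initial configuration, so the \<open>i\<close>-th request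
  is \<open>X ! (i - 1)\<close>. Values of \<open>p\<close> outside \<open>i \<le> length X\<close>, \<open>j < k\<close> play no role.
\<close>

definition valid_solution :: "nat \<Rightarrow> real list \<Rightarrow> (nat \<Rightarrow> nat \<Rightarrow> real) \<Rightarrow> bool" where
  "valid_solution k X p \<longleftrightarrow>
     (\<forall>i \<le> length X. \<forall>j < k. p i j \<in> {0..1}) \<and>
     (\<forall>j < k. p 0 j = 0) \<and>
     (\<forall>i \<in> {1..length X}. \<exists>j < k. p i j = X ! (i - 1))"

definition solution_cost :: "nat \<Rightarrow> real list \<Rightarrow> (nat \<Rightarrow> nat \<Rightarrow> real) \<Rightarrow> real" where
  "solution_cost k X p = (\<Sum>i = 1..length X. \<Sum>j < k. \<bar>p i j - p (i - 1) j\<bar>)"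

definition OPT :: "nat \<Rightarrow> real list \<Rightarrow> real" where
  "OPT k X = Inf {solution_cost k X p | p. valid_solution k X p}"

text \<open>The infimum is a minimum for every request sequence in the unit interval.\<close>

lemma OPT_attained:
  assumes "k > 0" and X: "set X \<subseteq> {0..1}"
  shows "\<exists>p. valid_solution k X p \<and> OPT k X = solution_cost k X p \<and>
    (\<forall>q. valid_solution k X q \<longrightarrow> solution_cost k X p \<le> solution_cost k X q)"
proof -
  define K :: "(nat \<Rightarrow> nat \<Rightarrow> real) set" where "K = {p. \<forall>i j. p i j \<in> {0..1}}"
  define S where "S = K \<inter> {p. valid_solution k X p}"
  have row: "compact {f :: nat \<Rightarrow> real. \<forall>j. f j \<in> {0..1}}"
  proof -
    have "compact (PiE UNIV (\<lambda>_. {0..1}) :: (nat \<Rightarrow> real) set)"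
      using compactin_PiE[of "\<lambda>_::nat. euclidean :: real topology" UNIV "\<lambda>_. {0..1}"]
      by (simp add: euclidean_product_topology)
    then show ?thesis by (simp add: PiE_UNIV_domain Pi_def)
  qed
  have "compact (PiE UNIV (\<lambda>_. {f. \<forall>j. f j \<in> {0..1}}) :: (nat \<Rightarrow> nat \<Rightarrow> real) set)"
    using compactin_PiE[of "\<lambda>_::nat. euclidean :: (nat \<Rightarrow> real) topology" UNIV
        "\<lambda>_. {f. \<forall>j. f j \<in> {0..1}}"] row
    by (simp add: euclidean_product_topology)
  then have K: "compact K"
    unfolding K_def by (simp add: PiE_UNIV_domain Pi_def)
  have cont: "continuous_on UNIV (\<lambda>p :: nat \<Rightarrow> nat \<Rightarrow> real. p i j)" for i j
    by (rule continuous_on_product_then_coordinatewise[OF continuous_on_product_coordinates])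
  have clU: "closed {p :: nat \<Rightarrow> nat \<Rightarrow> real. p i j = c}" for i j c
    by (rule closed_Collect_eq[OF cont continuous_on_const])
  define Z where "Z = (\<Inter>j\<in>{..<k}. {p :: nat \<Rightarrow> nat \<Rightarrow> real. p 0 j = 0}) \<inter>
      (\<Inter>i\<in>{1..length X}. \<Union>j\<in>{..<k}. {p. p i j = X ! (i - 1)})"
  have "p \<in> Z \<longleftrightarrow> (\<forall>j < k. p 0 j = 0) \<and>
      (\<forall>i \<in> {1..length X}. \<exists>j < k. p i j = X ! (i - 1))" for p
    by (simp only: Z_def Int_iff INT_iff UN_iff mem_Collect_eq lessThan_iff Ball_def Bex_def)
  then have "S = K \<inter> Z"
    unfolding S_def K_def valid_solution_def by (intro set_eqI) (auto simp only: Int_iff mem_Collect_eq)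
  moreover have "closed Z"
    unfolding Z_def
    by (intro closed_Int closed_INT closed_UN ballI finite_lessThan) (rule clU)+
  ultimately have S: "compact S"
    using K compact_Int_closed by metis
  have "(\<lambda>i j. if i \<in> {1..length X} then X ! (i - 1) else 0) \<in> S"
  proof -
    have "X ! (i - 1) \<in> {0..1}" if "i \<in> {1..length X}" for i
      using that X nth_mem[of "i - 1" X] by fastforce
    then show ?thesis
      unfolding S_def K_def valid_solution_def using \<open>k > 0\<close> by auto
  qed
  then have ne: "S \<noteq> {}" by blast
  have "continuous_on S (\<lambda>p. p i j)" for i j
    using cont continuous_on_subset by blast
  then have "continuous_on S (\<lambda>p. \<Sum>i = 1..length X. \<Sum>j < k. \<bar>p i j - p (i - 1) j\<bar>)"
    by (intro continuous_on_sum continuous_on_rabs continuous_on_diff)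
  then have "continuous_on S (solution_cost k X)"
    by (simp add: solution_cost_def[abs_def])
  from continuous_attains_inf[OF S ne this] obtain p where p: "p \<in> S"
    and min: "\<And>q. q \<in> S \<Longrightarrow> solution_cost k X p \<le> solution_cost k X q" by blast
  have le: "solution_cost k X p \<le> solution_cost k X q" if q: "valid_solution k X q" for q
  proof -
    define q' where "q' = (\<lambda>i j. if i \<le> length X \<and> j < k then q i j else 0)"
    have "q' \<in> S"
      using q unfolding S_def K_def valid_solution_def q'_def by auto
    moreover have "solution_cost k X q' = solution_cost k X q"
      unfolding solution_cost_def q'_def by (intro sum.cong) auto
    ultimately show ?thesis using min by metis
  qed
  have v: "valid_solution k X p" using p by (simp add: S_def)
  have "OPT k X = solution_cost k X p"
    unfolding OPT_def by (rule cInf_eq_minimum) (use v le in auto)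
  with v le show ?thesis by blast
qed

end

theory Submission
  imports Defs
begin

text \<open>
  Requests \<open>(1, B\<^sub>1, 1, B\<^sub>2, \<dots>, 1, B\<^sub>M)\<close>, where the \<open>B\<^sub>i\<close> are scaled copies of a hard sequence
  for one server fewer, stacked in decreasing order inside \<open>[0, 1/2]\<close>. In each round \<open>(1, B\<^sub>i)\<close>
  the server that handles the request \<open>1\<close> either also serves some request of \<open>B\<^sub>i\<close>, hence
  travels at least \<open>1/2\<close>, or leaves \<open>B\<^sub>i\<close> to the other servers, which pay at least \<open>1/2\<close> by
  induction. The decreasing order of the blocks prevents the pattern 132. The lower bound holds
  for arbitrary initial positions, so it is invariant under reflection and time reversal, which
  yields the other three patterns.
\<close>

section \<open>Serving cost with free initial positions\<close>

text \<open>Here \<open>p i\<close> is the configuration that serves \<open>X ! i\<close>. No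
  configuration precedes the first request, and positions may be any reals.\<close>

definition serves :: "nat set \<Rightarrow> real list \<Rightarrow> (nat \<Rightarrow> nat \<Rightarrow> real) \<Rightarrow> bool" where
  "serves J X p \<longleftrightarrow> (\<forall>i < length X. \<exists>j \<in> J. p i j = X ! i)"

definition travel :: "nat set \<Rightarrow> nat \<Rightarrow> (nat \<Rightarrow> nat \<Rightarrow> real) \<Rightarrow> real" where
  "travel J n p = (\<Sum>i < n - 1. \<Sum>j \<in> J. \<bar>p (Suc i) j - p i j\<bar>)"

text \<open>Server sets are arbitrary, so that a single server can be discarded.\<close>

definition hard :: "nat \<Rightarrow> real \<Rightarrow> real list \<Rightarrow> bool" where
  "hard k C X \<longleftrightarrow> (\<forall>J p. finite J \<longrightarrow> card J = k \<longrightarrow> serves J X p \<longrightarrow> C \<le> travel J (length X) p)"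

lemma hardI:
  assumes "\<And>J p. finite J \<Longrightarrow> card J = k \<Longrightarrow> serves J X p \<Longrightarrow> C \<le> travel J (length X) p"
  shows "hard k C X"
  using assms unfolding hard_def by blast

lemma hardD:
  assumes "hard k C X" "finite J" "card J = k" "serves J X p"
  shows "C \<le> travel J (length X) p"
  using assms unfolding hard_def by blast

lemma travel_nonneg: "0 \<le> travel J n p"
  unfolding travel_def by (intro sum_nonneg) auto

text \<open>For two nonempty parts, the move from \<open>p (m - 1)\<close> to \<open>p m\<close>
  belongs to neither and is dropped, hence only an inequality.\<close>

lemma travel_append: "travel J m p + travel J n (\<lambda>i. p (m + i)) \<le> travel J (m + n) p"
proof -
  let ?g = "\<lambda>i. \<Sum>j \<in> J. \<bar>p (Suc i) j - p i j\<bar>"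
  have nn: "0 \<le> ?g i" for i by (intro sum_nonneg) auto
  have "travel J n (\<lambda>i. p (m + i)) = (\<Sum>i < n - 1. ?g (i + m))"
    unfolding travel_def by (simp add: add.commute)
  also have "\<dots> = sum ?g {m..<m + (n - 1)}"
    using sum.shift_bounds_nat_ivl[of ?g 0 m "n - 1"]
    by (simp add: atLeast0LessThan add.commute)
  finally have "travel J m p + travel J n (\<lambda>i. p (m + i)) = sum ?g ({..<m - 1} \<union> {m..<m + (n - 1)})"
    unfolding travel_def by (subst sum.union_disjoint) auto
  also have "\<dots> \<le> sum ?g {..<m + n - 1}"
    by (intro sum_mono2) (use nn in auto)
  finally show ?thesis unfolding travel_def .
qed

lemma hard_zero: "hard k 0 X"
  by (intro hardI travel_nonneg)

text \<open>Vacuous: an empty server set serves no request, so every \<open>C\<close> is a bound.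
  This starts the induction on \<open>k\<close>.\<close>

lemma hard_no_servers:
  assumes "X \<noteq> []"
  shows "hard 0 C X"
  using assms by (intro hardI) (auto simp: serves_def)

text \<open>The second part starts wherever the first left the servers. Since \<open>hard\<close>
  allows any starting configuration, the bounds add.\<close>

lemma hard_append:
  assumes "hard k a X" "hard k b Y"
  shows "hard k (a + b) (X @ Y)"
proof (rule hardI)
  fix J p assume J: "finite J" "card J = k" and s: "serves J (X @ Y) p"
  have "serves J X p"
    unfolding serves_def
  proof (intro allI impI)
    fix i assume "i < length X"
    with s[unfolded serves_def, rule_format, of i] show "\<exists>j\<in>J. p i j = X ! i"
      by (simp add: nth_append)
  qed
  moreover have "serves J Y (\<lambda>i. p (length X + i))"
    unfolding serves_def
  proof (intro allI impI)
    fix i assume "i < length Y"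
    with s[unfolded serves_def, rule_format, of "length X + i"]
    show "\<exists>j\<in>J. p (length X + i) j = Y ! i"
      by (simp add: nth_append)
  qed
  ultimately show "a + b \<le> travel J (length (X @ Y)) p"
    using hardD[OF assms(1) J, of p] hardD[OF assms(2) J, of "\<lambda>i. p (length X + i)"]
      travel_append[of J "length X" p "length Y"] by simp
qed

lemma hard_concat:
  assumes "\<And>X. X \<in> set Xs \<Longrightarrow> hard k c X"
  shows "hard k (real (length Xs) * c) (concat Xs)"
  using assms
proof (induction Xs)
  case Nil
  show ?case by (simp add: hard_zero)
next
  case (Cons X Xs)
  then have "hard k (c + real (length Xs) * c) (X @ concat Xs)"
    by (intro hard_append) auto
  then show ?case by (simp add: algebra_simps)
qed

text \<open>Pulling a solution back along the inverse map divides every move by the absolute value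
  of \<open>w\<close>. A negative \<open>w\<close> covers reflection.\<close>

lemma hard_affine:
  assumes h: "hard k C X" and "w \<noteq> 0"
  shows "hard k (\<bar>w\<bar> * C) (map (\<lambda>x. a + w * x) X)"
proof (rule hardI)
  fix J p assume J: "finite J" "card J = k" and s: "serves J (map (\<lambda>x. a + w * x) X) p"
  let ?q = "\<lambda>i j. (p i j - a) / w"
  have "serves J X ?q"
    using s \<open>w \<noteq> 0\<close> unfolding serves_def by (fastforce simp: field_simps)
  then have "C \<le> travel J (length X) ?q" by (rule hardD[OF h J])
  moreover have "\<bar>w\<bar> * \<bar>?q (Suc i) j - ?q i j\<bar> = \<bar>p (Suc i) j - p i j\<bar>" for i j
    using \<open>w \<noteq> 0\<close> by (simp add: abs_mult[symmetric] field_simps)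
  then have "\<bar>w\<bar> * travel J (length X) ?q = travel J (length X) p"
    unfolding travel_def sum_distrib_left by simp
  ultimately show "\<bar>w\<bar> * C \<le> travel J (length (map (\<lambda>x. a + w * x) X)) p"
    by (metis abs_ge_zero length_map mult_left_mono)
qed

text \<open>A solution run backwards in time makes the same moves in opposite order, and no initial
  configuration breaks the symmetry.\<close>

lemma hard_rev:
  assumes h: "hard k C X"
  shows "hard k C (rev X)"
proof (rule hardI)
  fix J p assume J: "finite J" "card J = k" and s: "serves J (rev X) p"
  let ?n = "length X"
  let ?q = "\<lambda>i. p (?n - Suc i)"
  have "serves J X ?q"
    unfolding serves_def
  proof (intro allI impI)
    fix i assume "i < ?n"
    then show "\<exists>j\<in>J. ?q i j = X ! i"
      using s[unfolded serves_def, rule_format, of "?n - Suc i"] by (simp add: rev_nth)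
  qed
  then have "C \<le> travel J ?n ?q" by (rule hardD[OF h J])
  \<comment> \<open>Each move is indexed by \<open>?n - 1 - Suc i\<close>, the form in which
    \<open>sum.nat_diff_reindex\<close> reverses a sum.\<close>
  also have "\<dots> = (\<Sum>i < ?n - 1. \<Sum>j \<in> J. \<bar>p (Suc (?n - 1 - Suc i)) j - p (?n - 1 - Suc i) j\<bar>)"
    unfolding travel_def
  proof (intro sum.cong refl)
    fix i j assume "i \<in> {..<?n - 1}"
    then have "?n - Suc i = Suc (?n - 1 - Suc i)" "?n - Suc (Suc i) = ?n - 1 - Suc i" by auto
    then show "\<bar>?q (Suc i) j - ?q i j\<bar> = \<bar>p (Suc (?n - 1 - Suc i)) j - p (?n - 1 - Suc i) j\<bar>"
      by (simp only: abs_minus_commute)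
  qed
  also have "\<dots> = travel J ?n p"
    unfolding travel_def by (rule sum.nat_diff_reindex)
  finally show "C \<le> travel J (length (rev X)) p" by simp
qed

lemma displacement_le_travel:
  assumes "finite J" "j \<in> J" "i < n"
  shows "\<bar>p i j - p 0 j\<bar> \<le> travel J n p"
proof -
  have "\<bar>p i j - p 0 j\<bar> = \<bar>\<Sum>l < i. p (Suc l) j - p l j\<bar>"
    using sum_lessThan_telescope[of "\<lambda>l. p l j" i] by simp
  also have "\<dots> \<le> (\<Sum>l < i. \<bar>p (Suc l) j - p l j\<bar>)" by (rule sum_abs)
  also have "\<dots> \<le> (\<Sum>l < i. \<Sum>j \<in> J. \<bar>p (Suc l) j - p l j\<bar>)"
    using assms by (intro sum_mono member_le_sum) auto
  also have "\<dots> \<le> travel J n p"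
    unfolding travel_def using assms by (intro sum_mono2 sum_nonneg) auto
  finally show ?thesis .
qed

lemma hard_Cons_one:
  assumes h: "hard k C Y" and le: "\<And>y. y \<in> set Y \<Longrightarrow> y \<le> 1/2"
  shows "hard (Suc k) (min C (1/2)) (1 # Y)"
proof (rule hardI)
  fix J p assume J: "finite J" "card J = Suc k" and s: "serves J (1 # Y) p"
  let ?n = "length Y"
  from s[unfolded serves_def, rule_format, of 0] obtain j0 where j0: "j0 \<in> J" "p 0 j0 = 1" by auto
  show "min C (1/2) \<le> travel J (length (1 # Y)) p"
  \<comment> \<open>It only matters whether \<open>j0\<close> ever stands on the current request,
    even together with another server. If it never does, every serving server differs from
    \<open>j0\<close>.\<close>
  proof (cases "\<exists>i < ?n. p (Suc i) j0 = Y ! i")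
    case True
    then obtain i where i: "i < ?n" "p (Suc i) j0 = Y ! i" by blast
    then have "p (Suc i) j0 \<le> 1/2" using le nth_mem by simp
    then show ?thesis
      using displacement_le_travel[OF J(1) j0(1), of "Suc i" "Suc ?n" p] i(1) j0(2) by simp
  next
    case False
    have "serves (J - {j0}) Y (\<lambda>i. p (Suc i))"
      unfolding serves_def
    proof (intro allI impI)
      fix i assume i: "i < ?n"
      with s[unfolded serves_def, rule_format, of "Suc i"] obtain j where
        "j \<in> J" "p (Suc i) j = Y ! i" by auto
      with False i show "\<exists>j\<in>J - {j0}. p (Suc i) j = Y ! i" by blast
    qed
    then have "C \<le> travel (J - {j0}) ?n (\<lambda>i. p (Suc i))"
      using J j0 by (intro hardD[OF h]) auto
    also have "\<dots> \<le> travel J ?n (\<lambda>i. p (Suc i))"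
      unfolding travel_def using J(1) by (intro sum_mono sum_mono2) auto
    also have "\<dots> \<le> travel J (Suc ?n) p"
      using travel_append[of J 1 p ?n] travel_nonneg[of J 1 p] by simp
    finally show ?thesis by simp
  qed
qed

section \<open>From free initial positions to \<open>OPT\<close>\<close>

lemma hard_le_OPT:
  assumes h: "hard k C X" and "k > 0" "set X \<subseteq> {0..1}"
  shows "C \<le> OPT k X"
proof -
  from OPT_attained[OF assms(2,3)] obtain p where
    v: "valid_solution k X p" and opt: "OPT k X = solution_cost k X p" by blast
  have "serves {..<k} X (\<lambda>i. p (Suc i))"
    unfolding serves_def
  proof (intro allI impI)
    fix i assume "i < length X"
    then have "Suc i \<in> {1..length X}" by simp
    with v show "\<exists>j\<in>{..<k}. p (Suc i) j = X ! i"
      unfolding valid_solution_def by fastforce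
  qed
  then have "C \<le> travel {..<k} (length X) (\<lambda>i. p (Suc i))"
    by (intro hardD[OF h]) auto
  \<comment> \<open>The dropped move leads from the all-zero start to the configuration of the first
    request; adding it back only raises the cost.\<close>
  also have "\<dots> \<le> travel {..<k} (Suc (length X)) p"
    using travel_append[of "{..<k}" 1 p "length X"] travel_nonneg[of "{..<k}" 1 p] by simp
  also have "\<dots> = solution_cost k X p"
    unfolding travel_def solution_cost_def
    by (simp add: sum.atLeast1_atMost_eq)
  finally show ?thesis using opt by simp
qed

text \<open>Some server has to go from its start 0 to 1. This bound relies on the start: with free
  initial positions a constant sequence costs nothing.\<close>

lemma OPT_replicate_one:
  assumes "k > 0" "n > 0"
  shows "1 \<le> OPT k (replicate n 1)"
proof -
  have "set (replicate n 1 :: real list) \<subseteq> {0..1}" by auto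
  from OPT_attained[OF assms(1) this] obtain p where
    v: "valid_solution k (replicate n 1) p"
    and opt: "OPT k (replicate n 1) = solution_cost k (replicate n 1) p" by blast
  have "1 \<in> {1..length (replicate n (1 :: real))}" using assms(2) by simp
  with v obtain j where "j < k" "p 1 j = replicate n 1 ! (1 - 1)"
    unfolding valid_solution_def by blast
  with v assms(2) have j: "j < k" "p 1 j = 1" "p 0 j = 0"
    unfolding valid_solution_def by auto
  have "1 = \<bar>p 1 j - p (1 - 1) j\<bar>" using j by simp
  also have "\<dots> \<le> (\<Sum>j < k. \<bar>p 1 j - p (1 - 1) j\<bar>)"
    by (rule member_le_sum) (use j in auto)
  also have "\<dots> \<le> solution_cost k (replicate n 1) p"
    unfolding solution_cost_def
    by (rule member_le_sum[where f = "\<lambda>i. \<Sum>j < k. \<bar>p i j - p (i - 1) j\<bar>"])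
      (use assms in \<open>auto intro: sum_nonneg\<close>)
  finally show ?thesis using opt by simp
qed

section \<open>Pattern avoidance\<close>

lemma contains_pattern_map:
  assumes mono: "strict_mono f"
  shows "contains_pattern (map f X) Y \<longleftrightarrow> contains_pattern X Y"
proof -
  have iso: "order_isomorphic (map f Z) Y \<longleftrightarrow> order_isomorphic Z Y" for Z
    using strict_mono_less[OF mono] by (auto simp: order_isomorphic_def)
  show ?thesis
    unfolding contains_pattern_def subseq_conv_nths by (auto simp: nths_map iso)
qed

text \<open>Reflection swaps the roles of \<open>i\<close> and \<open>j\<close> on both sides of the
  equivalence. The centres \<open>a\<close> and \<open>b\<close> are independent since only the
  order counts.\<close>

lemma contains_pattern_reflect:
  "contains_pattern (map (\<lambda>x. a - x) X) (map (\<lambda>x. b - x) Y) \<longleftrightarrow> contains_pattern X Y"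
proof -
  have iso: "order_isomorphic (map (\<lambda>x. a - x) Z) (map (\<lambda>x. b - x) Y) \<longleftrightarrow> order_isomorphic Z Y" for Z
    by (auto simp: order_isomorphic_def)
  show ?thesis
    unfolding contains_pattern_def subseq_conv_nths by (auto simp: nths_map iso)
qed

lemma subseq_imp_set_subset: "subseq xs ys \<Longrightarrow> set xs \<subseteq> set ys"
  using set_nths_subset unfolding subseq_conv_nths by fast

lemma subseq_imp_subseq_rev:
  assumes "subseq xs ys"
  shows "subseq (rev xs) (rev ys)"
  using assms
proof (induction rule: list_emb.induct)
  case (list_emb_Cons xs ys y)
  then show ?case by (simp add: subseq_rev_drop_many)
qed simp_all

lemma order_isomorphic_rev:
  assumes "order_isomorphic xs ys"
  shows "order_isomorphic (rev xs) (rev ys)"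
  using assms by (auto simp: order_isomorphic_def rev_nth)

lemma contains_pattern_rev:
  "contains_pattern (rev X) (rev Y) \<longleftrightarrow> contains_pattern X Y"
proof -
  have *: "contains_pattern (rev X) (rev Y)" if "contains_pattern X Y" for X Y
    using that order_isomorphic_rev unfolding contains_pattern_def
    by (metis subseq_imp_subseq_rev)
  show ?thesis using *[of X Y] *[of "rev X" "rev Y"] by auto
qed

lemma contains_132_iff:
  "contains_pattern X [1, 3, 2] \<longleftrightarrow> (\<exists>a b c. subseq [a, b, c] X \<and> a < c \<and> c < b)"
proof -
  have iso: "order_isomorphic [a, b, c] [1, 3, 2] \<longleftrightarrow> a < c \<and> c < b" for a b c
    unfolding order_isomorphic_def by (simp add: All_less_Suc nth_Cons') linarith
  have "order_isomorphic Z [1, 3, 2] \<longleftrightarrow> (\<exists>a b c. Z = [a, b, c] \<and> a < c \<and> c < b)" for Z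
  proof
    assume Z: "order_isomorphic Z [1, 3, 2]"
    then have "length Z = length [1, 3, 2 :: real]" unfolding order_isomorphic_def ..
    then have "length Z = Suc (Suc (Suc 0))" by simp
    then obtain a b c where "Z = [a, b, c]"
      unfolding length_Suc_conv by blast
    with Z show "\<exists>a b c. Z = [a, b, c] \<and> a < c \<and> c < b" by (simp add: iso)
  qed (auto simp: iso)
  then show ?thesis by (auto simp: contains_pattern_def)
qed

text \<open>In an occurrence across the cut, the smallest entry \<open>a\<close> lies in
  \<open>X\<close> and \<open>c\<close> in \<open>Y\<close>. Then \<open>a < c\<close> forces
  \<open>c = 1\<close>, which leaves no room for \<open>b\<close> above \<open>c\<close>. The
  exception \<open>y = 1\<close> admits the recurring requests at 1.\<close>

lemma avoids_132_append:
  assumes X: "avoids_pattern X [1, 3, 2]" and Y: "avoids_pattern Y [1, 3, 2]"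
    and le1: "\<And>x. x \<in> set (X @ Y) \<Longrightarrow> x \<le> 1"
    and desc: "\<And>x y. x \<in> set X \<Longrightarrow> y \<in> set Y \<Longrightarrow> y = 1 \<or> y \<le> x"
  shows "avoids_pattern (X @ Y) [1, 3, 2]"
proof
  assume "contains_pattern (X @ Y) [1, 3, 2]"
  then obtain a b c where sub: "subseq [a, b, c] (X @ Y)" and ord: "a < c" "c < b"
    unfolding contains_132_iff by blast
  from sub obtain us vs where split: "[a, b, c] = us @ vs" "subseq us X" "subseq vs Y"
    by (auto elim: subseq_appendE)
  have "set [a, b, c] \<subseteq> set (X @ Y)" using sub by (rule subseq_imp_set_subset)
  then have "b \<le> 1" using le1 by auto
  consider "us = []" | "vs = []" | "us \<noteq> []" "vs \<noteq> []" by blast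
  then show False
  proof cases
    case 1
    with split have "subseq [a, b, c] Y" by simp
    with Y ord show False unfolding contains_132_iff by blast
  next
    case 2
    with split have "subseq [a, b, c] X" by simp
    with X ord show False unfolding contains_132_iff by blast
  next
    case 3
    \<comment> \<open>This holds on whichever side of the cut \<open>b\<close> falls.\<close>
    then have "a = hd us" "c = last vs"
      using arg_cong[OF split(1), of hd] arg_cong[OF split(1), of last] by auto
    with 3 have "a \<in> set us" "c \<in> set vs" by auto
    with split have "a \<in> set X" "c \<in> set Y" by (blast dest: subseq_imp_set_subset)+
    from desc[OF this] ord \<open>b \<le> 1\<close> show False by linarith
  qed
qed

lemma avoids_replicate:
  assumes "i < length Y" "j < length Y" "Y ! i < Y ! j"
  shows "avoids_pattern (replicate r a) Y"
proof
  assume "contains_pattern (replicate r a) Y"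
  then obtain Z where Z: "subseq Z (replicate r a)" "order_isomorphic Z Y"
    unfolding contains_pattern_def by blast
  have "set Z \<subseteq> {a}"
    using subseq_imp_set_subset[OF Z(1)] by (auto simp: set_replicate_conv_if split: if_splits)
  then have "Z ! l = a" if "l < length Z" for l using that nth_mem by blast
  with Z(2) assms show False unfolding order_isomorphic_def by (metis less_irrefl)
qed

lemma avoids_132_replicate: "avoids_pattern (replicate r a) [1, 3, 2]"
  by (rule avoids_replicate[of 0 _ 1]) auto

section \<open>The hard sequence\<close>

text \<open>Copy \<open>t\<close> is scaled into the interval from \<open>t / (2 * M)\<close> to
  \<open>(t + 1) / (2 * M)\<close>, and \<open>rev\<close> puts the highest copy first. Doubling the
  parameter offsets the scaling: the bound \<open>2 * M / 2\<close> for a copy shrinks to exactly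
  1/2.\<close>

fun hard_seq :: "nat \<Rightarrow> nat \<Rightarrow> real list" where
  "hard_seq 0 M = [0]"
| "hard_seq (Suc k) M = concat (map
     (\<lambda>t. 1 # map (\<lambda>x. (real t + x) / (2 * real M)) (hard_seq k (2 * M))) (rev [0..<M]))"

lemma set_hard_seq: "set (hard_seq k M) \<subseteq> {0..1}"
proof (induction k arbitrary: M)
  case (Suc k)
  have "0 \<le> (real t + x) / (2 * real M) \<and> (real t + x) / (2 * real M) \<le> 1"
    if "t < M" "x \<in> set (hard_seq k (2 * M))" for t x
  proof -
    have "0 \<le> x" "x \<le> 1" using Suc[of "2 * M"] that(2) by auto
    moreover have "real t + 1 \<le> real M" using that(1) by simp
    ultimately show ?thesis by (simp add: divide_le_eq)
  qed
  then show ?case by auto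
qed simp

lemma hard_hard_seq:
  assumes "M > 0"
  shows "hard k (real M / 2) (hard_seq k M)"
  using assms
proof (induction k arbitrary: M)
  case 0
  show ?case by (simp add: hard_no_servers)
next
  case (Suc k)
  let ?B = "\<lambda>t. map (\<lambda>x. (real t + x) / (2 * real M)) (hard_seq k (2 * M))"
  have block: "hard (Suc k) (1/2) (1 # ?B t)" if "t < M" for t
  proof -
    have "hard k (real (2 * M) / 2) (hard_seq k (2 * M))" by (rule Suc.IH) (use Suc.prems in simp)
    then have "hard k (\<bar>1 / (2 * real M)\<bar> * (real (2 * M) / 2))
        (map (\<lambda>x. real t / (2 * real M) + 1 / (2 * real M) * x) (hard_seq k (2 * M)))"
      by (rule hard_affine) (use Suc.prems in simp)
    moreover have "\<bar>1 / (2 * real M)\<bar> * (real (2 * M) / 2) = 1/2" using Suc.prems by simp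
    ultimately have "hard k (1/2) (?B t)"
      using Suc.prems by (simp add: add_divide_distrib)
    moreover have "y \<le> 1/2" if "y \<in> set (?B t)" for y
    proof -
      from that obtain x where x: "x \<in> set (hard_seq k (2 * M))" "y = (real t + x) / (2 * real M)"
        by auto
      have "x \<le> 1" using set_hard_seq x(1) by fastforce
      moreover have "real t + 1 \<le> real M" using \<open>t < M\<close> by simp
      ultimately show ?thesis using x(2) Suc.prems by (simp add: divide_le_eq)
    qed
    ultimately show ?thesis using hard_Cons_one[of k "1/2" "?B t"] by simp
  qed
  have "hard (Suc k) (real (length (map (\<lambda>t. 1 # ?B t) (rev [0..<M]))) * (1/2))
      (concat (map (\<lambda>t. 1 # ?B t) (rev [0..<M])))"
    by (rule hard_concat) (use block in auto)
  then show ?case by simp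
qed

lemma avoids_hard_seq: "avoids_pattern (hard_seq k M) [1, 3, 2]"
proof (induction k arbitrary: M)
  case 0
  show ?case using avoids_132_replicate[of 1 0] by simp
next
  case (Suc k)
  show ?case
  proof (cases "M = 0")
    case True
    then show ?thesis using avoids_132_replicate[of 0 0] by simp
  next
    case False
    define B where "B t = map (\<lambda>x. (real t + x) / (2 * real M)) (hard_seq k (2 * M))" for t
    have B: "real t / (2 * real M) \<le> y" "y \<le> real (Suc t) / (2 * real M)"
      if "y \<in> set (B t)" for y t
      using that set_hard_seq[of k "2 * M"] False unfolding B_def by (auto intro!: divide_right_mono)
    have B1: "y \<le> 1" if "y \<in> set (B t)" "t < M" for y t
    proof -
      have "real (Suc t) / (2 * real M) \<le> 1" using that(2) by (simp add: divide_le_eq)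
      with B(2)[OF that(1)] show ?thesis by linarith
    qed
    have avB: "avoids_pattern (1 # B t) [1, 3, 2]" if "t < M" for t
    proof -
      have "strict_mono (\<lambda>x. (real t + x) / (2 * real M))"
        using False by (intro strict_monoI divide_strict_right_mono) auto
      then have "avoids_pattern (B t) [1, 3, 2]"
        unfolding B_def using contains_pattern_map Suc by blast
      then have "avoids_pattern ([1] @ B t) [1, 3, 2]"
        using avoids_132_replicate[of 1 1] B1 that by (intro avoids_132_append) auto
      then show ?thesis by simp
    qed
    \<comment> \<open>Induction on the number \<open>m\<close> of lowest blocks with the scale
      \<open>M\<close> fixed: block \<open>m\<close> is put in front of all lower ones.\<close>
    have "avoids_pattern (concat (map (\<lambda>t. 1 # B t) (rev [0..<m]))) [1, 3, 2]" if "m \<le> M" for m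
      using that
    proof (induction m)
      case 0
      show ?case using avoids_132_replicate[of 0 0] by simp
    next
      case (Suc m)
      let ?L = "concat (map (\<lambda>t. 1 # B t) (rev [0..<m]))"
      have le1: "x \<le> 1" if "x \<in> set ((1 # B m) @ ?L)" for x
        using that B1 Suc.prems by (auto split: if_splits)
      have "y = 1 \<or> y \<le> x" if x: "x \<in> set (1 # B m)" and y: "y \<in> set ?L" for x y
      \<comment> \<open>Away from 1, \<open>m / (2 * M)\<close> separates block \<open>m\<close>
        from the lower ones. Neighbouring blocks may share this endpoint, as the comparison is not
        strict.\<close>
      proof (cases "y = 1 \<or> x = 1")
        case True
        then show ?thesis using le1[of y] y by auto
      next
        case False
        with x y obtain t where "t < m" "y \<in> set (B t)" "x \<in> set (B m)"
          by (auto split: if_splits)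
        moreover have "real (Suc t) / (2 * real M) \<le> real m / (2 * real M)"
          using \<open>t < m\<close> by (intro divide_right_mono) auto
        ultimately show ?thesis using B(1)[of x m] B(2)[of y t] by linarith
      qed
      with le1 Suc avB[of m] have "avoids_pattern ((1 # B m) @ ?L) [1, 3, 2]"
        by (intro avoids_132_append) auto
      then show ?case by simp
    qed
    from this[of M] show ?thesis by (simp add: B_def)
  qed
qed

lemma length_hard_seq:
  assumes "M > 0"
  shows "0 < length (hard_seq k M) \<and> length (hard_seq k M) \<le> (2 ^ k * M) ^ k"
  using assms
proof (induction k arbitrary: M)
  case (Suc k)
  let ?l = "length (hard_seq k (2 * M))"
  have len: "length (hard_seq (Suc k) M) = M * Suc ?l"
    by (simp add: length_concat comp_def sum_list_triv)
  have IH: "0 < ?l" "?l \<le> (2 ^ k * (2 * M)) ^ k" using Suc.IH[of "2 * M"] Suc.prems by auto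
  \<comment> \<open>Positivity of \<open>?l\<close> gives \<open>Suc ?l \<le> 2 * ?l\<close>, which
    absorbs the leading request 1 of each block; this is why the lemma carries positivity
    along.\<close>
  have "M * Suc ?l \<le> M * (2 * (2 ^ k * (2 * M)) ^ k)"
    using IH by (intro mult_le_mono2) linarith
  also have "\<dots> = (2 * M) * (2 ^ Suc k * M) ^ k" by (simp add: ac_simps)
  also have "\<dots> \<le> (2 ^ Suc k * M) * (2 ^ Suc k * M) ^ k"
    by (intro mult_le_mono1) simp
  finally show ?case using len Suc.prems by simp
qed simp

section \<open>Choice of parameters and the four patterns\<close>

theorem theorem3p13:
  shows "\<exists>c::real. c > 0 \<and>
    (\<forall>\<sigma> \<in> {[1, 3, 2], [2, 1, 3], [2, 3, 1], [3, 1, 2]}. \<forall>n k :: nat. n > 0 \<longrightarrow> k > 0 \<longrightarrow>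
      (\<exists>X :: real list. length X = n \<and> set X \<subseteq> {0..1} \<and> avoids_pattern X \<sigma> \<and>
         OPT k X \<ge> c * 4 powr (- real k) * real n powr (1 / real k)))"
proof (intro exI[of _ "1/4 :: real"] conjI ballI allI impI)
  fix \<sigma> :: "real list" and n k :: nat
  assume \<sigma>: "\<sigma> \<in> {[1, 3, 2], [2, 1, 3], [2, 3, 1], [3, 1, 2]}" and n: "n > 0" and k: "k > 0"
  \<comment> \<open>231 is the reverse of 132, 312 its complement and 213 its reverse complement.
    The map \<open>4 - x\<close> permutes the pattern values 1, 2, 3.\<close>
  have avoid_cases: "\<exists>X' \<in> {X, rev X, map (\<lambda>x. 1 - x) X, map (\<lambda>x. 1 - x) (rev X)}. avoids_pattern X' \<sigma>"
    if X: "avoids_pattern X [1, 3, 2]" for X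
  proof -
    have r: "avoids_pattern (rev X) [2, 3, 1]"
      using X contains_pattern_rev[of X "[1, 3, 2]"] by simp
    have "avoids_pattern (map (\<lambda>x. 1 - x) X) [3, 1, 2]"
      using X contains_pattern_reflect[of 1 X 4 "[1, 3, 2]"] by simp
    moreover have "avoids_pattern (map (\<lambda>x. 1 - x) (rev X)) [2, 1, 3]"
      using r contains_pattern_reflect[of 1 "rev X" 4 "[2, 3, 1]"] by simp
    ultimately show ?thesis using X r \<sigma> by auto
  qed
  define r where "r = real n powr (1 / real k)"
  \<comment> \<open>The largest \<open>M\<close> with \<open>(2 ^ k * M) ^ k \<le> n\<close>, so
    that by \<open>length_hard_seq\<close> the hard sequence fits into \<open>n\<close>
    requests.\<close>
  define M where "M = nat \<lfloor>r / 2 ^ k\<rfloor>"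
  have r: "r > 0" "r ^ k = real n"
    using n k by (simp_all add: r_def powr_realpow[symmetric] powr_powr)
  have p4: "(4::real) powr (- real k) = 1 / 4 ^ k"
    by (simp add: powr_minus powr_realpow divide_inverse)
  have p24: "(2::real) ^ k \<le> 4 ^ k" by (intro power_mono) auto
  show "\<exists>X. length X = n \<and> set X \<subseteq> {0..1} \<and> avoids_pattern X \<sigma> \<and>
      OPT k X \<ge> 1/4 * 4 powr (- real k) * real n powr (1 / real k)"
  proof (cases "M = 0")
    case True
    \<comment> \<open>For such small \<open>n\<close> the target is at most 1, and one trip from 0
      to 1 pays for it.\<close>
    then have "r / 2 ^ k < 1" unfolding M_def by linarith
    then have "r \<le> 4 ^ k" using p24 by (simp add: divide_less_eq)
    have "avoids_pattern (replicate n 1) \<sigma>"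
    proof -
      have "\<exists>i < length \<sigma>. \<exists>j < length \<sigma>. \<sigma> ! i < \<sigma> ! j"
        using \<sigma> by (auto simp: Ex_less_Suc)
      then show ?thesis using avoids_replicate by blast
    qed
    moreover have "1/4 * 4 powr (- real k) * r \<le> 1"
      using \<open>r \<le> 4 ^ k\<close> r by (simp add: p4 divide_le_eq)
    ultimately show ?thesis
      using OPT_replicate_one[OF k n] unfolding r_def
      by (intro exI[of _ "replicate n 1"]) auto
  next
    case False
    then have "1 \<le> M" by simp
    have Mr: "real M \<le> r / 2 ^ k" unfolding M_def using r by simp
    \<comment> \<open>Rounding down loses at most a factor 2 because \<open>M\<close> is at least 1.
      Together with the bound \<open>M / 2\<close> this yields the constant 1/4.\<close>
    have rM: "r / 2 ^ k \<le> 2 * real M"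
      using \<open>1 \<le> M\<close> real_of_int_floor_add_one_gt[of "r / 2 ^ k"] unfolding M_def by linarith
    let ?H = "hard_seq k M"
    \<comment> \<open>Padding with 1 reaches length exactly \<open>n\<close>; it creates no 132, and
      by \<open>hard_zero\<close> the bound survives.\<close>
    define X where "X = ?H @ replicate (n - length ?H) 1"
    have "real ((2 ^ k * M) ^ k) \<le> r ^ k"
      using power_mono[of "2 ^ k * real M" r k] Mr by (simp add: field_simps)
    then have "length ?H \<le> n"
      using r(2) length_hard_seq[of M k] \<open>1 \<le> M\<close> by (simp flip: of_nat_power of_nat_mult)
    then have len: "length X = n" by (simp add: X_def)
    have X01: "set X \<subseteq> {0..1}" using set_hard_seq[of k M] by (auto simp: X_def)
    have "avoids_pattern X [1, 3, 2]"
      unfolding X_def using set_hard_seq[of k M]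
      by (intro avoids_132_append avoids_hard_seq avoids_132_replicate) auto
    from avoid_cases[OF this] obtain X' where
      X': "X' \<in> {X, rev X, map (\<lambda>x. 1 - x) X, map (\<lambda>x. 1 - x) (rev X)}" "avoids_pattern X' \<sigma>"
      by blast
    have hX: "hard k (real M / 2) X"
      using hard_append[OF hard_hard_seq[of M k] hard_zero] \<open>1 \<le> M\<close> unfolding X_def by simp
    have reflect: "hard k C (map (\<lambda>x. 1 - x) Y)" if "hard k C Y" for C Y
      using hard_affine[OF that, of "-1" 1] by simp
    have "hard k (real M / 2) X'"
      using X'(1) hX by (auto intro: reflect hard_rev)
    moreover have X'01: "set X' \<subseteq> {0..1}" using X'(1) X01 by fastforce
    ultimately have "real M / 2 \<le> OPT k X'" using k by (intro hard_le_OPT)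
    moreover have "1/4 * 4 powr (- real k) * r \<le> real M / 2"
    proof -
      \<comment> \<open>The construction gives the denominator \<open>2 ^ k\<close>, here weakened
        to the \<open>4 ^ k\<close> of the claim.\<close>
      have "r / 4 ^ k \<le> r / 2 ^ k" using p24 r by (intro divide_left_mono) auto
      with rM show ?thesis by (simp add: p4)
    qed
    moreover have "length X' = n" using X'(1) len by auto
    ultimately show ?thesis using X'(2) X'01 unfolding r_def by (intro exI[of _ X']) linarith
  qed
qed simp

end
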